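(* Given a DSC $(E,\mathrm{dep})$, the poset $\mathsf{rdp}(E)$ is a finite distributive lattice if and only if $(E,\mathrm{dep})$ is a DSNC, i.e. $\mathrm{dep}(e)$ is a singleton for every $e\in E$.
   Context: $P(A)$ denotes the power set of $A$. A preDSC is a pair $(E,\mathrm{dep})$ with $E$ a finite set and $\mathrm{dep}:E\to P(P(E))$ a function; elements of $\mathrm{dep}(e)$ are called depsets of $e$. For $X,Y\subseteq E$ write $X\,\mathrm{rch}\,Y$ if $X\subseteq Y$ and for every $y\in Y$ there is $D\in\mathrm{dep}(y)$ with $D\subseteq X$. A subset $X\subseteq E$ is reachable if there is a finite sequence of subsets with $\varnothing\,\mathrm{rch}\,X_0\,\mathrm{rch}\cdots\mathrm{rch}\,X_n\,\mathrm{rch}\,X$. $\mathsf{rdp}(E)$ is the poset of reachable subsets ordered by inclusion. A subset $X$ is complete if every $e\in X$ has a depset $D\in\mathrm{dep}(e)$ with $D\subseteq X$. A DSC is a preDSC which is irredundant ($D_0\subseteq D_1$ with $D_0,D_1\in\mathrm{dep}(e)$ implies $D_0=D_1$), acyclic ($e\notin D$ for all $D\in\mathrm{dep}(e)$), nonsingular ($\mathrm{dep}(e)\neq\varnothing$ for all $e$) and has complete depsets (all $D\in\mathrm{dep}(e)$ are complete). A DSNC (dependency structure with no choice) is a DSC such that $\mathrm{dep}(e)$ is a singleton for every $e\in E$. *)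

theory Defs
  imports "HOL-Algebra.Lattice"
begin

text \<open>The values of \<open>dep\<close> outside \<open>E\<close> are junk and are constrained by none of the notions below.\<close>

locale preDSC =
  fixes E :: "'a set" and dep :: "'a \<Rightarrow> 'a set set"
  assumes finite_E: "finite E"
    and dep_subset: "e \<in> E \<Longrightarrow> dep e \<subseteq> Pow E"

definition rch :: "'a set \<Rightarrow> ('a \<Rightarrow> 'a set set) \<Rightarrow> 'a set \<Rightarrow> 'a set \<Rightarrow> bool" where
  "rch E dep X Y \<longleftrightarrow>
     X \<subseteq> E \<and> Y \<subseteq> E \<and> X \<subseteq> Y \<and> (\<forall>y\<in>Y. \<exists>D\<in>dep y. D \<subseteq> X)"

definition reachable :: "'a set \<Rightarrow> ('a \<Rightarrow> 'a set set) \<Rightarrow> 'a set \<Rightarrow> bool" where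
  "reachable E dep X \<longleftrightarrow>
     (\<exists>(n::nat) (Xs :: nat \<Rightarrow> 'a set).
        rch E dep {} (Xs 0) \<and> (\<forall>i<n. rch E dep (Xs i) (Xs (Suc i))) \<and> rch E dep (Xs n) X)"

definition complete_in :: "'a set \<Rightarrow> ('a \<Rightarrow> 'a set set) \<Rightarrow> 'a set \<Rightarrow> bool" where
  "complete_in E dep X \<longleftrightarrow> X \<subseteq> E \<and> (\<forall>e\<in>X. \<exists>D\<in>dep e. D \<subseteq> X)"

locale DSC = preDSC +
  assumes irredundant: "\<lbrakk>e \<in> E; D0 \<in> dep e; D1 \<in> dep e; D0 \<subseteq> D1\<rbrakk> \<Longrightarrow> D0 = D1"
    and acyclic: "\<lbrakk>e \<in> E; D \<in> dep e\<rbrakk> \<Longrightarrow> e \<notin> D"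
    and nonsingular: "e \<in> E \<Longrightarrow> dep e \<noteq> {}"
    and complete_depsets: "\<lbrakk>e \<in> E; D \<in> dep e\<rbrakk> \<Longrightarrow> complete_in E dep D"

locale DSNC = DSC +
  assumes no_choice: "e \<in> E \<Longrightarrow> is_singleton (dep e)"

definition rdp :: "'a set \<Rightarrow> ('a \<Rightarrow> 'a set set) \<Rightarrow> 'a set gorder" where
  "rdp E dep = \<lparr>carrier = {X. reachable E dep X}, eq = (=), le = (\<subseteq>)\<rparr>"

text \<open>
  Joins and meets are those of the poset \<open>L\<close> itself; in \<open>rdp E dep\<close> the meet of two
  elements need not be their intersection.
\<close>

locale distributive_lattice = lattice +
  assumes meet_join_distrib:
    "\<lbrakk>x \<in> carrier L; y \<in> carrier L; z \<in> carrier L\<rbrakk>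
       \<Longrightarrow> x \<sqinter> (y \<squnion> z) = (x \<sqinter> y) \<squnion> (x \<sqinter> z)"

locale finite_distributive_lattice = distributive_lattice +
  assumes finite_carrier: "finite (carrier L)"

end

theory Submission
  imports Defs
begin

text \<open>
  In a DSC the reachable sets are exactly the complete ones: a complete set can be built up one
  element at a time, because acyclicity together with completeness of the depsets forbids circular
  dependencies (\<open>complete_has_next_element\<close>). Complete sets are closed under union, so unions are
  the joins of \<open>rdp E dep\<close>.

  If every element has a single depset, complete sets are closed under intersection as well: the one
  depset of an element lies in every complete set that contains the element. Hence
  \<open>rdp E dep\<close> is a finite lattice of sets with union and intersection as operations, which is
  distributive.

  Conversely, suppose that some \<open>e\<close> has distinct depsets \<open>D\<close> and \<open>D'\<close>. Then
  \<open>x = insert e D\<close>, \<open>y = insert e D'\<close> and \<open>D\<close> are complete, and \<open>x\<close> lies below the join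
  of \<open>y\<close> and \<open>D\<close>. Distributivity would make \<open>x\<close> the union of its meets with \<open>y\<close> and with
  \<open>D\<close>, so that \<open>e\<close> lies in one of them. The meet with \<open>D\<close> misses \<open>e\<close> since \<open>e \<notin> D\<close>.
  The meet with \<open>y\<close> is only a complete subset of \<open>x \<inter> y\<close>, and \<open>e\<close> could belong to it only by
  having a depset inside both \<open>D\<close> and \<open>D'\<close>, against irredundance.
\<close>

section \<open>Reachable sets are the complete sets\<close>

lemma rch_imp_complete:
  "rch E dep X Y \<Longrightarrow> complete_in E dep Y"
  unfolding rch_def complete_in_def by blast

lemma reachable_imp_complete:
  "reachable E dep X \<Longrightarrow> complete_in E dep X"
  unfolding reachable_def using rch_imp_complete by metis

lemma reachable_empty: "reachable E dep {}"
proof -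
  have "rch E dep {} {}"
    by (simp add: rch_def)
  then show ?thesis
    unfolding reachable_def by (intro exI[of _ "0::nat"] exI[of _ "\<lambda>_. {}"] conjI) simp_all
qed

lemma reachable_step:
  assumes "reachable E dep X" "rch E dep X Y"
  shows "reachable E dep Y"
proof -
  obtain n :: nat and Xs where Xs: "rch E dep {} (Xs 0)"
    "\<forall>i<n. rch E dep (Xs i) (Xs (Suc i))" "rch E dep (Xs n) X"
    using assms(1) unfolding reachable_def by (elim exE conjE)
  let ?Ys = "Xs(Suc n := X)"
  have "rch E dep {} (?Ys 0)"
    using Xs by simp
  moreover have "\<forall>i<Suc n. rch E dep (?Ys i) (?Ys (Suc i))"
    using Xs(2,3) by (simp add: less_Suc_eq)
  moreover have "rch E dep (?Ys (Suc n)) Y"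
    using assms(2) by simp
  ultimately show ?thesis
    unfolding reachable_def by (intro exI[of _ "Suc n"] exI[of _ ?Ys] conjI)
qed

lemma complete_Un:
  "complete_in E dep X \<Longrightarrow> complete_in E dep Y \<Longrightarrow> complete_in E dep (X \<union> Y)"
  unfolding complete_in_def ball_Un by (meson Un_least le_supI1 le_supI2)

context DSC
begin

text \<open>
  Descend from an element of \<open>Z\<close> outside \<open>Y\<close> to a depset inside \<open>Z\<close>. The depset is again
  complete and, by acyclicity, strictly smaller than \<open>Z\<close>, so the descent ends at an element of \<open>Z\<close>
  outside \<open>Y\<close> that has a depset inside \<open>Y\<close>.
\<close>

lemma complete_has_next_element:
  assumes "complete_in E dep Z" "\<not> Z \<subseteq> Y"
  shows "\<exists>e\<in>Z - Y. \<exists>D\<in>dep e. D \<subseteq> Y"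
proof -
  have "finite Z"
    using assms(1) finite_subset[OF _ finite_E] by (simp add: complete_in_def)
  then show ?thesis
    using assms
  proof (induction Z rule: finite_psubset_induct)
    case (psubset Z)
    obtain e D where e: "e \<in> Z" "e \<notin> Y" "e \<in> E" and D: "D \<in> dep e" "D \<subseteq> Z"
      using psubset.prems unfolding complete_in_def by blast
    show ?case
    proof (cases "D \<subseteq> Y")
      case True
      then show ?thesis
        using e D by blast
    next
      case False
      have "D \<subset> Z"
        using acyclic[OF e(3) D(1)] e(1) D(2) by blast
      moreover have "complete_in E dep D"
        using complete_depsets e(3) D(1) .
      ultimately have "\<exists>e\<in>D - Y. \<exists>D\<in>dep e. D \<subseteq> Y"
        using psubset.IH[of D] False by simp
      then show ?thesis
        using D(2) by blast
    qed
  qed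
qed

text \<open>
  A maximal reachable subset of \<open>X\<close> must be all of \<open>X\<close>, since otherwise it could be enlarged
  by the next element of \<open>X\<close>.
\<close>

lemma complete_imp_reachable:
  assumes X: "complete_in E dep X"
  shows "reachable E dep X"
proof -
  have "X \<subseteq> E"
    using X unfolding complete_in_def by blast
  let ?R = "{Y. reachable E dep Y \<and> Y \<subseteq> X}"
  have "finite X"
    using \<open>X \<subseteq> E\<close> finite_E by (rule finite_subset)
  then have "finite ?R"
    by simp
  moreover have "?R \<noteq> {}"
    using reachable_empty[of E dep] by auto
  ultimately obtain Y where "Y \<in> ?R" and max: "\<And>Z. Z \<in> ?R \<Longrightarrow> Y \<subseteq> Z \<Longrightarrow> Y = Z"
    using finite_has_maximal[of ?R] by meson
  then have Y: "reachable E dep Y" "Y \<subseteq> X"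
    by simp_all
  have "X \<subseteq> Y"
  proof (rule ccontr)
    assume "\<not> X \<subseteq> Y"
    then obtain e D where e: "e \<in> X" "e \<notin> Y" "D \<in> dep e" "D \<subseteq> Y"
      using complete_has_next_element[OF X] by blast
    have "rch E dep Y (insert e Y)"
      using e reachable_imp_complete[OF Y(1)] \<open>X \<subseteq> E\<close> by (auto simp: rch_def complete_in_def)
    with Y(1) have "reachable E dep (insert e Y)"
      by (rule reachable_step)
    then show False
      using max[of "insert e Y"] e Y(2) by auto
  qed
  then show ?thesis
    using Y by auto
qed

lemma reachable_iff_complete: "reachable E dep X \<longleftrightarrow> complete_in E dep X"
  using reachable_imp_complete complete_imp_reachable by blast

lemma carrier_rdp: "carrier (rdp E dep) = {X. complete_in E dep X}"
  by (simp add: rdp_def reachable_iff_complete)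

lemma complete_insert_depset:
  "e \<in> E \<Longrightarrow> D \<in> dep e \<Longrightarrow> complete_in E dep (insert e D)"
  using complete_depsets[of e D] unfolding complete_in_def
  by auto (meson subset_insertI subset_insertI2)+

end

section \<open>Joins of reachable sets\<close>

lemma le_rdp [simp]: "X \<sqsubseteq>\<^bsub>rdp E dep\<^esub> Y \<longleftrightarrow> X \<subseteq> Y"
  by (simp add: rdp_def)

lemma partial_order_rdp: "partial_order (rdp E dep)"
  by unfold_locales (auto simp: rdp_def)

context DSC
begin

lemma least_Upper_rdp_Un:
  assumes "X \<in> carrier (rdp E dep)" "Y \<in> carrier (rdp E dep)"
  shows "least (rdp E dep) (X \<union> Y) (Upper (rdp E dep) {X, Y})"
proof (rule least_UpperI)
  show "X \<union> Y \<in> carrier (rdp E dep)"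
    using assms by (simp add: carrier_rdp complete_Un)
qed (use assms in \<open>auto simp: Upper_def\<close>)

lemma join_rdp:
  assumes "upper_semilattice (rdp E dep)"
    and "X \<in> carrier (rdp E dep)" "Y \<in> carrier (rdp E dep)"
  shows "X \<squnion>\<^bsub>rdp E dep\<^esub> Y = X \<union> Y"
proof -
  interpret upper_semilattice "rdp E dep" by fact
  show ?thesis
    by (rule joinI[OF _ assms(2,3)]) (rule least_unique[OF _ least_Upper_rdp_Un[OF assms(2,3)]])
qed

section \<open>Distributivity excludes choice\<close>

text \<open>
  The element \<open>e\<close> belongs to the join of \<open>insert e D'\<close> and \<open>D\<close>, hence, by distributivity, to the
  meet of \<open>insert e D\<close> with one of them. Irredundance rules out the first when \<open>D \<noteq> D'\<close>, and
  acyclicity the second.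
\<close>

lemma depset_unique_if_distributive:
  assumes "distributive_lattice (rdp E dep)"
    and e: "e \<in> E" and D: "D \<in> dep e" and D': "D' \<in> dep e"
  shows "D = D'"
proof -
  interpret distributive_lattice "rdp E dep" by fact
  let ?L = "rdp E dep" and ?x = "insert e D" and ?y = "insert e D'"
  have x: "?x \<in> carrier ?L" and y: "?y \<in> carrier ?L" and z: "D \<in> carrier ?L"
    using complete_insert_depset[OF e D] complete_insert_depset[OF e D']
      complete_depsets[OF e D] by (auto simp: carrier_rdp)
  have "upper_semilattice ?L" ..
  note join = join_rdp[OF this]
  have "?x \<subseteq> ?x \<sqinter>\<^bsub>?L\<^esub> (?y \<squnion>\<^bsub>?L\<^esub> D)"
    using meet_le[OF _ _ x join_closed[OF y z] x] by (auto simp: join[OF y z])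
  also have "\<dots> = (?x \<sqinter>\<^bsub>?L\<^esub> ?y) \<union> (?x \<sqinter>\<^bsub>?L\<^esub> D)"
    unfolding meet_join_distrib[OF x y z] by (rule join[OF meet_closed[OF x y] meet_closed[OF x z]])
  finally have "e \<in> ?x \<sqinter>\<^bsub>?L\<^esub> ?y \<or> e \<in> ?x \<sqinter>\<^bsub>?L\<^esub> D"
    by blast
  moreover have "e \<notin> ?x \<sqinter>\<^bsub>?L\<^esub> D"
    using meet_right[OF x z] acyclic[OF e D] by auto
  ultimately have "e \<in> ?x \<sqinter>\<^bsub>?L\<^esub> ?y"
    by blast
  moreover have "complete_in E dep (?x \<sqinter>\<^bsub>?L\<^esub> ?y)"
    using meet_closed[OF x y] by (simp add: carrier_rdp)
  ultimately obtain C where C: "C \<in> dep e" "C \<subseteq> ?x \<sqinter>\<^bsub>?L\<^esub> ?y"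
    unfolding complete_in_def by blast
  then have "C \<subseteq> D" "C \<subseteq> D'"
    using meet_left[OF x y] meet_right[OF x y] acyclic[OF e C(1)] by auto
  then show ?thesis
    using irredundant[OF e C(1)] D D' by blast
qed

end

section \<open>Without choice the reachable sets form a lattice of sets\<close>

context DSNC
begin

lemma complete_Int:
  assumes "complete_in E dep X" "complete_in E dep Y"
  shows "complete_in E dep (X \<inter> Y)"
  unfolding complete_in_def
proof (intro conjI ballI)
  show "X \<inter> Y \<subseteq> E"
    using assms unfolding complete_in_def by blast
next
  fix e
  assume e: "e \<in> X \<inter> Y"
  then have "e \<in> E"
    using assms unfolding complete_in_def by blast
  then obtain D where "dep e = {D}"
    using is_singletonE[OF no_choice] by metis
  moreover have "\<exists>D\<in>dep e. D \<subseteq> X" "\<exists>D\<in>dep e. D \<subseteq> Y"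
    using assms e unfolding complete_in_def by auto
  ultimately show "\<exists>D\<in>dep e. D \<subseteq> X \<inter> Y"
    by simp
qed

lemma greatest_Lower_rdp_Int:
  assumes "X \<in> carrier (rdp E dep)" "Y \<in> carrier (rdp E dep)"
  shows "greatest (rdp E dep) (X \<inter> Y) (Lower (rdp E dep) {X, Y})"
proof (rule greatest_LowerI)
  show "X \<inter> Y \<in> carrier (rdp E dep)"
    using assms by (simp add: carrier_rdp complete_Int)
qed (use assms in \<open>auto simp: Lower_def\<close>)

lemma lattice_rdp: "lattice (rdp E dep)"
proof -
  interpret partial_order "rdp E dep"
    by (rule partial_order_rdp)
  show ?thesis
    by unfold_locales (use least_Upper_rdp_Un greatest_Lower_rdp_Int in blast)+
qed

lemma meet_rdp:
  assumes "X \<in> carrier (rdp E dep)" "Y \<in> carrier (rdp E dep)"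
  shows "X \<sqinter>\<^bsub>rdp E dep\<^esub> Y = X \<inter> Y"
proof -
  interpret lattice "rdp E dep"
    by (rule lattice_rdp)
  show ?thesis
    by (rule meetI[OF _ assms]) (rule greatest_unique[OF _ greatest_Lower_rdp_Int[OF assms]])
qed

lemma finite_distributive_lattice_rdp: "finite_distributive_lattice (rdp E dep)"
proof -
  interpret lattice "rdp E dep"
    by (rule lattice_rdp)
  have "upper_semilattice (rdp E dep)" ..
  note join = join_rdp[OF this]
  show ?thesis
  proof unfold_locales
    fix X Y Z
    assume XYZ: "X \<in> carrier (rdp E dep)" "Y \<in> carrier (rdp E dep)" "Z \<in> carrier (rdp E dep)"
    have "X \<sqinter>\<^bsub>rdp E dep\<^esub> (Y \<squnion>\<^bsub>rdp E dep\<^esub> Z) = X \<inter> (Y \<union> Z)"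
      using XYZ join_closed[of Y Z] by (simp add: meet_rdp join)
    also have "\<dots> = (X \<inter> Y) \<union> (X \<inter> Z)"
      by blast
    also have "\<dots> = (X \<sqinter>\<^bsub>rdp E dep\<^esub> Y) \<squnion>\<^bsub>rdp E dep\<^esub> (X \<sqinter>\<^bsub>rdp E dep\<^esub> Z)"
      using XYZ meet_closed[of X Y] meet_closed[of X Z] by (simp add: meet_rdp join)
    finally show "X \<sqinter>\<^bsub>rdp E dep\<^esub> (Y \<squnion>\<^bsub>rdp E dep\<^esub> Z) =
      (X \<sqinter>\<^bsub>rdp E dep\<^esub> Y) \<squnion>\<^bsub>rdp E dep\<^esub> (X \<sqinter>\<^bsub>rdp E dep\<^esub> Z)" .
  next
    have "carrier (rdp E dep) \<subseteq> Pow E"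
      by (auto simp: carrier_rdp complete_in_def)
    then show "finite (carrier (rdp E dep))"
      by (rule finite_subset) (simp add: finite_E)
  qed
qed

end

section \<open>Distributivity is absence of choice\<close>

theorem proposition4p9:
  fixes E :: "'a set" and dep :: "'a \<Rightarrow> 'a set set"
  assumes "DSC E dep"
  shows "finite_distributive_lattice (rdp E dep) \<longleftrightarrow> DSNC E dep"
proof
  interpret DSC E dep by fact
  assume "finite_distributive_lattice (rdp E dep)"
  then interpret L: finite_distributive_lattice "rdp E dep" .
  show "DSNC E dep"
  proof unfold_locales
    fix e
    assume e: "e \<in> E"
    then obtain D where "D \<in> dep e"
      using nonsingular by blast
    then have "dep e = {D}"
      using depset_unique_if_distributive[OF L.distributive_lattice_axioms e] by blast
    then show "is_singleton (dep e)"
      by (simp add: is_singleton_def)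
  qed
next
  assume "DSNC E dep"
  then show "finite_distributive_lattice (rdp E dep)"
    by (rule DSNC.finite_distributive_lattice_rdp)
qed

end
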